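(* Let $T,d_x,d_w\ge 1$ be integers, let $w_1,\dots,w_T\in\mathbb{R}^{d_w}$ be fixed known (non-random) vectors, and let $\mathsf{W}=(w_1,\dots,w_T)\in\mathbb{R}^{d_w\times T}$. Let $Y=(Y_1,\dots,Y_T)'$ be a random vector in $\{0,1\}^T$, $X=(X_1,\dots,X_T)$ a random matrix in $\mathbb{R}^{d_x\times T}$ with columns $X_t$, and $A$ a random vector in $\mathbb{R}^{d_w}$ (unobserved), and suppose that for some parameter $\beta\in\mathbb{R}^{d_x}$ and all $y\in\{0,1\}^T$, $$\Pr(Y=y\mid X,A)=\prod_{t=1}^T\left[\frac{1}{1+\exp(X_t'\beta+w_t'A)}\right]^{1-y_t}\left[\frac{\exp(X_t'\beta+w_t'A)}{1+\exp(X_t'\beta+w_t'A)}\right]^{y_t}.$$ Assume further that for some integer $d_\perp\ge 1$ there exists a non-random matrix $\mathsf{W}_\perp\in\{-1,0,1\}^{T\times d_\perp}$ such that $\mathsf{W}\,\mathsf{W}_\perp=0$, and that there is no nonzero vector $b\in\mathbb{R}^{d_x}$ for which $b'X\mathsf{W}_\perp=0$ almost surely. Then the parameter $\beta$ is uniquely identified from the distribution of $(Y,X)$.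
   Context: No restriction is placed on the joint distribution of $(X,A)$ (apart from $A$ taking values in $\mathbb{R}^{d_w}$ and the stated condition on $X$); in particular $A$ and $X$ may be arbitrarily dependent. "$\beta$ is uniquely identified from the distribution of $(Y,X)$" means: if two parameter values $\beta,\tilde\beta\in\mathbb{R}^{d_x}$, each combined with some joint distribution of $(X,A)$ satisfying the assumptions, generate through the model the same joint distribution of the observables $(Y,X)$, then $\beta=\tilde\beta$. The prime denotes transpose. *)

theory Defs
  imports "HOL-Probability.Probability"
begin

text \<open>
  Conventions: the integers \<open>T, d\<^sub>x, d\<^sub>w\<close> are the cardinalities of the finite index types
  \<open>'t, 'x, 'w\<close>.  As \<open>real ^ 'n ^ 'm\<close> has rows indexed by \<open>'m\<close> and columns by \<open>'n\<close>, a
  \<open>d\<^sub>x \<times> T\<close> matrix has type \<open>real ^ 't ^ 'x\<close>, and \<open>X\<^sub>t\<close> is \<open>column t X\<close>.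
\<close>

definition binary_vectors :: "(nat ^ 't) set"
  where "binary_vectors = {y. \<forall>t. y $ t \<in> {0, 1}}"

definition logit_index :: "real ^ 't ^ 'w \<Rightarrow> real ^ 'x \<Rightarrow> real ^ 't ^ 'x \<Rightarrow> real ^ 'w \<Rightarrow> 't \<Rightarrow> real"
  where "logit_index W \<beta> x a t = column t x \<bullet> \<beta> + column t W \<bullet> a"

definition logit_prob ::
    "real ^ 't ^ 'w \<Rightarrow> real ^ 'x \<Rightarrow> real ^ 't ^ 'x \<Rightarrow> real ^ 'w \<Rightarrow> nat ^ 't \<Rightarrow> real"
  where "logit_prob W \<beta> x a y =
    (\<Prod>t\<in>UNIV.
      (1 / (1 + exp (logit_index W \<beta> x a t))) ^ (1 - y $ t) *
      (exp (logit_index W \<beta> x a t) / (1 + exp (logit_index W \<beta> x a t))) ^ (y $ t))"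

definition cond_prob_given ::
    "'a measure \<Rightarrow> 'b measure \<Rightarrow> ('a \<Rightarrow> 'b) \<Rightarrow> 'a set \<Rightarrow> 'a \<Rightarrow> real"
  where "cond_prob_given M N Z E =
    real_cond_exp M (vimage_algebra (space M) Z N) (indicat_real E)"

text \<open>
  Nothing is assumed about the joint law of \<open>(X, A)\<close> beyond the condition on \<open>X\<close>.
  The library totalises \<open>real_cond_exp\<close>; the measurability assumptions make the
  \<open>\<sigma>\<close>-algebra generated by \<open>(X, A)\<close> a sub-\<open>\<sigma>\<close>-algebra of \<open>M\<close>.
\<close>

definition panel_logit_model ::
    "'a measure \<Rightarrow> real ^ 't ^ 'w \<Rightarrow> real ^ 'x \<Rightarrow>
      ('a \<Rightarrow> nat ^ 't) \<Rightarrow> ('a \<Rightarrow> real ^ 't ^ 'x) \<Rightarrow> ('a \<Rightarrow> real ^ 'w) \<Rightarrow> bool"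
  where "panel_logit_model M W \<beta> Y X A \<longleftrightarrow>
    prob_space M \<and>
    Y \<in> measurable M (count_space binary_vectors) \<and>
    X \<in> borel_measurable M \<and>
    A \<in> borel_measurable M \<and>
    (\<forall>y\<in>binary_vectors. AE \<omega> in M.
      cond_prob_given M (borel \<Otimes>\<^sub>M borel) (\<lambda>\<omega>. (X \<omega>, A \<omega>)) {\<omega> \<in> space M. Y \<omega> = y} \<omega> =
        logit_prob W \<beta> (X \<omega>) (A \<omega>) y)"

definition differencing_matrix :: "real ^ 't ^ 'w \<Rightarrow> real ^ 'p ^ 't \<Rightarrow> bool"
  where "differencing_matrix W W_perp \<longleftrightarrow>
    (\<forall>t p. W_perp $ t $ p \<in> {-1, 0, 1}) \<and> W ** W_perp = 0"

definition no_degenerate_direction ::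
    "'a measure \<Rightarrow> ('a \<Rightarrow> real ^ 't ^ 'x) \<Rightarrow> real ^ 'p ^ 't \<Rightarrow> bool"
  where "no_degenerate_direction M X W_perp \<longleftrightarrow>
    \<not> (\<exists>b. b \<noteq> 0 \<and> (AE \<omega> in M. b v* (X \<omega> ** W_perp) = 0))"

definition observable_law ::
    "'a measure \<Rightarrow> ('a \<Rightarrow> nat ^ 't) \<Rightarrow> ('a \<Rightarrow> real ^ 't ^ 'x) \<Rightarrow> ((nat ^ 't) \<times> (real ^ 't ^ 'x)) measure"
  where "observable_law M Y X =
    distr M (count_space binary_vectors \<Otimes>\<^sub>M borel) (\<lambda>\<omega>. (Y \<omega>, X \<omega>))"

end

theory Submission
  imports Defs
begin

text \<open>
  Fix a column \<open>v\<close> of \<open>W_perp\<close> and compare the outcomes \<open>y\<^sup>+ = 1{v = 1}\<close> and \<open>y\<^sup>- = 1{v = -1}\<close>.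
  Since \<open>y\<^sup>+ - y\<^sup>- = v\<close> and \<open>W v = 0\<close>, the odds of \<open>y\<^sup>+\<close> against \<open>y\<^sup>-\<close> given \<open>(X, A)\<close> are
  \<open>exp (\<beta>' X v)\<close>, free of \<open>A\<close>.  Hence the law of \<open>X\<close> on \<open>{Y = y\<^sup>+}\<close> has density
  \<open>exp (\<beta>' X v)\<close> with respect to the law of \<open>X\<close> on \<open>{Y = y\<^sup>-}\<close>.  Both laws are observable and
  densities are unique, so \<open>\<beta>' X v\<close> is determined on \<open>{Y = y\<^sup>-}\<close>, and hence almost surely,
  because \<open>y\<^sup>-\<close> has positive conditional probability everywhere.
\<close>

text \<open>The negative part of an indicator vanishes and its positive part is at most 1. This
  carries the model assumption over to \<open>nn_cond_exp\<close>, which can be integrated against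
  nonnegative weights without integrability conditions.\<close>

lemma (in sigma_finite_subalgebra) real_cond_exp_indicator_eq_nn:
  assumes [measurable]: "E \<in> sets M"
  shows "AE x in M. ennreal (real_cond_exp M F (indicat_real E) x) = nn_cond_exp M F (indicator E) x"
proof -
  have le: "AE x in M. nn_cond_exp M F (indicator E) x \<le> nn_cond_exp M F (\<lambda>_. 1) x"
    by (rule nn_cond_exp_mono) (auto split: split_indicator)
  have one: "AE x in M. 1 = nn_cond_exp M F (\<lambda>_. 1) x"
    by (rule nn_cond_exp_F_meas[of "\<lambda>_. 1"]) simp
  have zero: "AE x in M. 0 = nn_cond_exp M F (\<lambda>_. 0) x"
    by (rule nn_cond_exp_F_meas[of "\<lambda>_. 0"]) simp
  have neg: "(\<lambda>x. ennreal (- indicat_real E x)) = (\<lambda>_. 0)"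
    by (auto simp: ennreal_neg)
  have pos: "(\<lambda>x. ennreal (indicat_real E x)) = indicator E"
    by (auto split: split_indicator)
  show ?thesis
    using le one zero
  proof eventually_elim
    case (elim x)
    \<comment> \<open>Finiteness matters because \<open>enn2real\<close> sends \<open>top\<close> to
      0.\<close>
    then have "nn_cond_exp M F (indicator E) x < top"
      by (metis ennreal_one_less_top order_le_less_trans)
    then show ?case
      unfolding real_cond_exp_def neg pos using elim(3)[symmetric] by simp
  qed
qed

section \<open>Logit probabilities and their odds\<close>

lemma logit_prob_pos: "0 < logit_prob W \<beta> x a y"
  unfolding logit_prob_def by (intro prod_pos ballI mult_pos_pos zero_less_power divide_pos_pos)
    (auto intro: add_pos_pos)

lemma measurable_logit_prob [measurable]:
  fixes W :: "real ^ 't ^ 'w" and \<beta> :: "real ^ 'x"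
  shows "(\<lambda>(x, a). logit_prob W \<beta> x a y) \<in> borel_measurable (borel \<Otimes>\<^sub>M borel)"
proof -
  have "1 + exp r \<noteq> 0" for r :: real
    using exp_gt_zero[of r] by linarith
  then have "continuous_on UNIV (\<lambda>z. logit_prob W \<beta> (fst z) (snd z) y)"
    unfolding logit_prob_def logit_index_def column_def by (intro continuous_intros) auto
  then show ?thesis
    unfolding borel_prod by (simp add: borel_measurable_continuous_onI case_prod_beta')
qed

text \<open>For entries in {-1, 0, 1} this is the positive part; applied to a column
  \<open>v\<close> and to \<open>- v\<close> it yields the outcomes \<open>y\<^sup>+\<close> and
  \<open>y\<^sup>-\<close>.\<close>

definition positive_part_vec :: "real ^ 't \<Rightarrow> nat ^ 't"
  where "positive_part_vec v = (\<chi> t. if v $ t = 1 then 1 else 0)"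

lemma positive_part_vec_binary: "positive_part_vec v \<in> binary_vectors"
  by (simp add: positive_part_vec_def binary_vectors_def)

text \<open>Each denominator occurs once for either outcome and cancels, so period t contributes the
  exponential of v_t times its index. Summing over t, the term in \<open>a\<close> vanishes because
  W v = 0.\<close>

lemma logit_prob_odds:
  fixes W :: "real ^ 't ^ 'w" and W_perp :: "real ^ 'p ^ 't" and \<beta> :: "real ^ 'x"
  assumes "differencing_matrix W W_perp"
  shows "logit_prob W \<beta> x a (positive_part_vec (column p W_perp)) =
    exp ((\<beta> v* (x ** W_perp)) $ p) * logit_prob W \<beta> x a (positive_part_vec (- column p W_perp))"
proof -
  let ?i = "logit_index W \<beta> x a"
  have entries: "W_perp $ t $ p = -1 \<or> W_perp $ t $ p = 0 \<or> W_perp $ t $ p = 1" for t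
    using assms by (auto simp: differencing_matrix_def)
  have "(W ** W_perp) $ i $ p = 0" for i
    using assms by (simp add: differencing_matrix_def)
  then have W0: "(\<Sum>t\<in>UNIV. W $ i $ t * W_perp $ t $ p) = 0" for i
    by (simp add: matrix_matrix_mult_def)
  \<comment> \<open>Exchanging the sums exposes the entries of \<open>W ** W_perp\<close> in column
    \<open>p\<close>.\<close>
  have "(\<Sum>t\<in>UNIV. W_perp $ t $ p * (column t W \<bullet> a)) =
      (\<Sum>i\<in>UNIV. a $ i * (\<Sum>t\<in>UNIV. W $ i $ t * W_perp $ t $ p))"
    by (simp add: column_def inner_vec_def sum_distrib_left, subst sum.swap)
      (simp add: mult_ac)
  then have Wa: "(\<Sum>t\<in>UNIV. W_perp $ t $ p * (column t W \<bullet> a)) = 0"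
    by (simp add: W0)
  have x\<beta>: "(\<Sum>t\<in>UNIV. W_perp $ t $ p * (column t x \<bullet> \<beta>)) = (\<beta> v* (x ** W_perp)) $ p"
    by (simp add: column_def inner_vec_def sum_distrib_left sum_distrib_right
        vector_matrix_mult_def matrix_matrix_mult_def, subst sum.swap) (simp add: mult_ac)
  have "(\<Sum>t\<in>UNIV. W_perp $ t $ p * ?i t) = (\<beta> v* (x ** W_perp)) $ p"
    using Wa x\<beta> by (simp add: logit_index_def distrib_left sum.distrib)
  then have exp_eq: "exp ((\<beta> v* (x ** W_perp)) $ p) = (\<Prod>t\<in>UNIV. exp (W_perp $ t $ p * ?i t))"
    by (simp flip: exp_sum)
  show ?thesis
    unfolding logit_prob_def exp_eq prod.distrib[symmetric]
  proof (rule prod.cong)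
    fix t
    show "(1 / (1 + exp (?i t))) ^ (1 - positive_part_vec (column p W_perp) $ t) *
        (exp (?i t) / (1 + exp (?i t))) ^ (positive_part_vec (column p W_perp) $ t) =
      exp (W_perp $ t $ p * ?i t) *
        ((1 / (1 + exp (?i t))) ^ (1 - positive_part_vec (- column p W_perp) $ t) *
        (exp (?i t) / (1 + exp (?i t))) ^ (positive_part_vec (- column p W_perp) $ t))"
      \<comment> \<open>At entry 0 both outcomes are 0 and the factors agree; at 1 and -1 exactly
        one outcome is 1, and the ratio is the exponential of plus or minus the index.\<close>
      using entries[of t] by (auto simp: positive_part_vec_def column_def exp_minus)
  qed simp
qed

section \<open>Integrating the conditional response probabilities\<close>

lemma measurable_response:
  assumes "panel_logit_model M W \<beta> Y X A" "y \<in> binary_vectors"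
  shows "{\<omega> \<in> space M. Y \<omega> = y} \<in> sets M"
proof -
  have "Y -` {y} \<inter> space M \<in> sets M"
    using assms by (intro measurable_sets[of Y M "count_space binary_vectors"])
      (auto simp: panel_logit_model_def)
  also have "Y -` {y} \<inter> space M = {\<omega> \<in> space M. Y \<omega> = y}" by auto
  finally show ?thesis .
qed

text \<open>The defining property of conditional expectation, with a weight measurable in (X, A).
  All later uses of the logit assumption pass through this identity.\<close>

lemma nn_integral_response:
  fixes W :: "real ^ 't ^ 'w" and \<beta> :: "real ^ 'x"
  assumes model: "panel_logit_model M W \<beta> Y X A" and y: "y \<in> binary_vectors"
    and g: "g \<in> borel_measurable (borel \<Otimes>\<^sub>M borel)"
  shows "(\<integral>\<^sup>+\<omega>. g (X \<omega>, A \<omega>) * indicator {\<omega> \<in> space M. Y \<omega> = y} \<omega> \<partial>M) =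
    (\<integral>\<^sup>+\<omega>. g (X \<omega>, A \<omega>) * ennreal (logit_prob W \<beta> (X \<omega>) (A \<omega>) y) \<partial>M)"
proof -
  let ?E = "{\<omega> \<in> space M. Y \<omega> = y}"
  let ?F = "vimage_algebra (space M) (\<lambda>\<omega>. (X \<omega>, A \<omega>)) (borel \<Otimes>\<^sub>M borel)"
  have [measurable]: "X \<in> borel_measurable M" "A \<in> borel_measurable M" and "prob_space M"
    using model by (auto simp: panel_logit_model_def)
  interpret prob_space M by fact
  have E [measurable]: "?E \<in> sets M"
    by (rule measurable_response[OF model y])
  have XA: "(\<lambda>\<omega>. (X \<omega>, A \<omega>)) \<in> measurable M (borel \<Otimes>\<^sub>M borel)"
    by measurable
  have "subalgebra M ?F"
    using measurable_sets[OF XA] by (auto simp: subalgebra_def sets_vimage_algebra2 space_pair_measure)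
  then interpret finite_measure_subalgebra M ?F
    by unfold_locales
  \<comment> \<open>Measurability with respect to the generated \<sigma>-algebra, not just
    \<open>M\<close>, is what makes \<open>g\<close> an admissible weight.\<close>
  have gF: "(\<lambda>\<omega>. g (X \<omega>, A \<omega>)) \<in> borel_measurable ?F"
    by (rule measurable_compose[OF measurable_vimage_algebra1 g]) (auto simp: space_pair_measure)
  have cond: "AE \<omega> in M. real_cond_exp M ?F (indicat_real ?E) \<omega> = logit_prob W \<beta> (X \<omega>) (A \<omega>) y"
    using model y by (simp add: panel_logit_model_def cond_prob_given_def)
  have "(\<integral>\<^sup>+\<omega>. g (X \<omega>, A \<omega>) * indicator ?E \<omega> \<partial>M) =
      (\<integral>\<^sup>+\<omega>. g (X \<omega>, A \<omega>) * nn_cond_exp M ?F (indicator ?E) \<omega> \<partial>M)"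
    using gF by (intro nn_cond_exp_intg[symmetric]) auto
  also have "\<dots> = (\<integral>\<^sup>+\<omega>. g (X \<omega>, A \<omega>) * ennreal (logit_prob W \<beta> (X \<omega>) (A \<omega>) y) \<partial>M)"
  proof (rule nn_integral_cong_AE)
    show "AE \<omega> in M. g (X \<omega>, A \<omega>) * nn_cond_exp M ?F (indicator ?E) \<omega> =
        g (X \<omega>, A \<omega>) * ennreal (logit_prob W \<beta> (X \<omega>) (A \<omega>) y)"
      using real_cond_exp_indicator_eq_nn[OF E] cond by eventually_elim metis
  qed
  finally show ?thesis .
qed

section \<open>Laws of the regressors on an outcome event\<close>

definition regressor_law_on ::
    "'a measure \<Rightarrow> ('a \<Rightarrow> nat ^ 't) \<Rightarrow> ('a \<Rightarrow> real ^ 't ^ 'x) \<Rightarrow> nat ^ 't \<Rightarrow> (real ^ 't ^ 'x) measure"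
  where "regressor_law_on M Y X y =
    distr (density M (indicator {\<omega> \<in> space M. Y \<omega> = y})) borel X"

lemma emeasure_regressor_law_on:
  assumes model: "panel_logit_model M W \<beta> Y X A" and y: "y \<in> binary_vectors" and B: "B \<in> sets borel"
  shows "emeasure (regressor_law_on M Y X y) B =
    (\<integral>\<^sup>+\<omega>. indicator B (X \<omega>) * indicator {\<omega> \<in> space M. Y \<omega> = y} \<omega> \<partial>M)"
proof -
  have [measurable]: "X \<in> borel_measurable M"
    using model by (auto simp: panel_logit_model_def)
  note [measurable] = measurable_response[OF model y] B
  show ?thesis
    unfolding regressor_law_on_def
    by (subst emeasure_distr; (subst emeasure_density)?)
      (auto intro!: nn_integral_cong split: split_indicator)
qed

text \<open>The law is left unnormalised, with total mass Pr(Y = y). Finiteness is what uniqueness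
  of densities will rest on.\<close>

lemma finite_measure_regressor_law_on:
  assumes model: "panel_logit_model M W \<beta> Y X A" and y: "y \<in> binary_vectors"
  shows "finite_measure (regressor_law_on M Y X y)"
proof
  interpret prob_space M
    using model by (simp add: panel_logit_model_def)
  have "emeasure (regressor_law_on M Y X y) UNIV \<le> (\<integral>\<^sup>+\<omega>. 1 \<partial>M)"
    unfolding emeasure_regressor_law_on[OF model y sets.top[of borel, unfolded space_borel]]
    by (intro nn_integral_mono) (auto split: split_indicator)
  then show "emeasure (regressor_law_on M Y X y) (space (regressor_law_on M Y X y)) \<noteq> \<infinity>"
    by (auto simp: regressor_law_on_def emeasure_space_1 top_unique)
qed

text \<open>A slice of the joint law of (Y, X): this is why these measures depend on observables
  only.\<close>

lemma regressor_law_on_observable: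
  assumes model: "panel_logit_model M W \<beta> Y X A" and y: "y \<in> binary_vectors" and B: "B \<in> sets borel"
  shows "emeasure (regressor_law_on M Y X y) B = emeasure (observable_law M Y X) ({y} \<times> B)"
proof -
  have [measurable]: "X \<in> borel_measurable M" "Y \<in> measurable M (count_space binary_vectors)"
    using model by (auto simp: panel_logit_model_def)
  note [measurable] = measurable_response[OF model y] B
  have yB: "{y} \<times> B \<in> sets (count_space binary_vectors \<Otimes>\<^sub>M borel)"
    using y by (intro pair_measureI) auto
  have "emeasure (observable_law M Y X) ({y} \<times> B) =
      emeasure M ((\<lambda>\<omega>. (Y \<omega>, X \<omega>)) -` ({y} \<times> B) \<inter> space M)"
    unfolding observable_law_def by (rule emeasure_distr) (use yB in auto)
  also have "\<dots> = (\<integral>\<^sup>+\<omega>. indicator ((\<lambda>\<omega>. (Y \<omega>, X \<omega>)) -` ({y} \<times> B) \<inter> space M) \<omega> \<partial>M)"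
    using yB by (intro nn_integral_indicator[symmetric] measurable_sets[OF _ yB]) measurable
  also have "\<dots> = emeasure (regressor_law_on M Y X y) B"
    unfolding emeasure_regressor_law_on[OF assms]
    by (intro nn_integral_cong) (auto split: split_indicator)
  finally show ?thesis ..
qed

lemma regressor_law_on_cong:
  assumes "panel_logit_model M W \<beta> Y X A" "panel_logit_model M' W' \<beta>' Y' X' A'"
    and "observable_law M Y X = observable_law M' Y' X'" and "y \<in> binary_vectors"
  shows "regressor_law_on M Y X y = regressor_law_on M' Y' X' y"
proof (rule measure_eqI)
  show "sets (regressor_law_on M Y X y) = sets (regressor_law_on M' Y' X' y)"
    by (simp add: regressor_law_on_def)
  fix B assume "B \<in> sets (regressor_law_on M Y X y)"
  then have "B \<in> sets borel" by (simp add: regressor_law_on_def)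
  then show "emeasure (regressor_law_on M Y X y) B = emeasure (regressor_law_on M' Y' X' y) B"
    using assms by (simp add: regressor_law_on_observable)
qed

lemma measurable_odds [measurable]:
  fixes W_perp :: "real ^ 'p ^ 't" and \<beta> :: "real ^ 'x"
  shows "(\<lambda>x :: real ^ 't ^ 'x. exp ((\<beta> v* (x ** W_perp)) $ p)) \<in> borel_measurable borel"
  unfolding vector_matrix_mult_def matrix_matrix_mult_def
  by (intro borel_measurable_continuous_onI continuous_intros)

text \<open>The odds depend on X alone, so they can be absorbed into the weight of
  \<open>nn_integral_response\<close>: it is applied forwards for \<open>?y1\<close>, then backwards
  for \<open>?y0\<close>.\<close>

lemma regressor_law_on_odds:
  fixes W :: "real ^ 't ^ 'w" and W_perp :: "real ^ 'p ^ 't" and \<beta> :: "real ^ 'x"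
  assumes model: "panel_logit_model M W \<beta> Y X A" and diff: "differencing_matrix W W_perp"
  shows "regressor_law_on M Y X (positive_part_vec (column p W_perp)) =
    density (regressor_law_on M Y X (positive_part_vec (- column p W_perp)))
      (\<lambda>x. ennreal (exp ((\<beta> v* (x ** W_perp)) $ p)))"
    (is "regressor_law_on M Y X ?y1 = density (regressor_law_on M Y X ?y0) ?r")
proof (rule measure_eqI)
  show "sets (regressor_law_on M Y X ?y1) = sets (density (regressor_law_on M Y X ?y0) ?r)"
    by (simp add: regressor_law_on_def)
  fix B assume "B \<in> sets (regressor_law_on M Y X ?y1)"
  then have B [measurable]: "B \<in> sets borel" by (simp add: regressor_law_on_def)
  have [measurable]: "X \<in> borel_measurable M"
    using model by (auto simp: panel_logit_model_def)
  note y0 = positive_part_vec_binary[of "- column p W_perp"]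
  note y1 = positive_part_vec_binary[of "column p W_perp"]
  note [measurable] = measurable_response[OF model y0]
  have "emeasure (regressor_law_on M Y X ?y1) B =
      (\<integral>\<^sup>+\<omega>. indicator B (X \<omega>) * ennreal (logit_prob W \<beta> (X \<omega>) (A \<omega>) ?y1) \<partial>M)"
    unfolding emeasure_regressor_law_on[OF model y1 B]
    using nn_integral_response[OF model y1, of "\<lambda>z. indicator B (fst z)"] by simp
  also have "\<dots> = (\<integral>\<^sup>+\<omega>. (?r (X \<omega>) * indicator B (X \<omega>)) *
      ennreal (logit_prob W \<beta> (X \<omega>) (A \<omega>) ?y0) \<partial>M)"
    unfolding logit_prob_odds[OF diff]
    by (simp add: ennreal_mult less_imp_le[OF logit_prob_pos] mult_ac)
  also have "\<dots> = (\<integral>\<^sup>+\<omega>. (?r (X \<omega>) * indicator B (X \<omega>)) *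
      indicator {\<omega> \<in> space M. Y \<omega> = ?y0} \<omega> \<partial>M)"
    using nn_integral_response[OF model y0, of "\<lambda>z. ?r (fst z) * indicator B (fst z)"] by simp
  also have "\<dots> = emeasure (density (regressor_law_on M Y X ?y0) ?r) B"
    unfolding regressor_law_on_def
    by (subst emeasure_density, simp, simp, subst nn_integral_distr, simp, simp,
        subst nn_integral_density) (simp_all add: mult_ac)
  finally show "emeasure (regressor_law_on M Y X ?y1) B =
      emeasure (density (regressor_law_on M Y X ?y0) ?r) B" .
qed

text \<open>Every outcome has positive probability given any (X, A), so a set of regressor values
  that is null on {Y = y} is null outright.\<close>

lemma AE_regressor_law_on_imp_AE:
  assumes model: "panel_logit_model M W \<beta> Y X A" and y: "y \<in> binary_vectors"
    and P [measurable]: "Measurable.pred borel P" and AE: "AE x in regressor_law_on M Y X y. P x"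
  shows "AE \<omega> in M. P (X \<omega>)"
proof -
  have [measurable]: "X \<in> borel_measurable M" "A \<in> borel_measurable M"
    using model by (auto simp: panel_logit_model_def)
  let ?g = "\<lambda>x. indicator {x. \<not> P x} x :: ennreal"
  note [measurable] = measurable_response[OF model y]
  have "AE \<omega> in M. Y \<omega> = y \<longrightarrow> P (X \<omega>)"
    using AE unfolding regressor_law_on_def
    by (simp add: AE_distr_iff AE_density) (auto elim!: AE_mp split: split_indicator)
  then have "(\<integral>\<^sup>+\<omega>. ?g (X \<omega>) * indicator {\<omega> \<in> space M. Y \<omega> = y} \<omega> \<partial>M) = 0"
    by (subst nn_integral_0_iff_AE) (auto elim!: eventually_mono split: split_indicator)
  then have "(\<integral>\<^sup>+\<omega>. ?g (X \<omega>) * ennreal (logit_prob W \<beta> (X \<omega>) (A \<omega>) y) \<partial>M) = 0"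
    using nn_integral_response[OF model y, of "\<lambda>z. ?g (fst z)"] by simp
  then have "AE \<omega> in M. ?g (X \<omega>) * ennreal (logit_prob W \<beta> (X \<omega>) (A \<omega>) y) = 0"
    by (subst (asm) nn_integral_0_iff_AE) auto
  then show ?thesis
    by eventually_elim
      (auto simp: ennreal_eq_0_iff not_le[THEN iffD2, OF logit_prob_pos] split: split_indicator_asm)
qed

theorem theorem1:
  fixes W :: "real ^ 't ^ 'w"
    and \<beta> \<beta>' :: "real ^ 'x"
    and W_perp :: "real ^ 'p ^ 't" and W_perp' :: "real ^ 'q ^ 't"
    and M :: "'a measure" and M' :: "'b measure"
    and Y :: "'a \<Rightarrow> nat ^ 't" and Y' :: "'b \<Rightarrow> nat ^ 't"
    and X :: "'a \<Rightarrow> real ^ 't ^ 'x" and X' :: "'b \<Rightarrow> real ^ 't ^ 'x"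
    and A :: "'a \<Rightarrow> real ^ 'w" and A' :: "'b \<Rightarrow> real ^ 'w"
  assumes "panel_logit_model M W \<beta> Y X A"
    and "differencing_matrix W W_perp" and "no_degenerate_direction M X W_perp"
    and "panel_logit_model M' W \<beta>' Y' X' A'"
    and "differencing_matrix W W_perp'" and "no_degenerate_direction M' X' W_perp'"
    and "observable_law M Y X = observable_law M' Y' X'"
  shows "\<beta> = \<beta>'"
proof (rule ccontr)
  assume "\<beta> \<noteq> \<beta>'"
  note model = assms(1) and diff = assms(2) and model' = assms(4)
  have "AE \<omega> in M. (\<beta> v* (X \<omega> ** W_perp)) $ p = (\<beta>' v* (X \<omega> ** W_perp)) $ p" for p
  proof -
    let ?y0 = "positive_part_vec (- column p W_perp)"
    let ?L = "regressor_law_on M Y X ?y0"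
    let ?r = "\<lambda>\<beta> x. ennreal (exp ((\<beta> v* (x ** W_perp)) $ p))"
    note cong = regressor_law_on_cong[OF model model' assms(7) positive_part_vec_binary]
    have sets [measurable_cong]: "sets ?L = sets borel"
      by (simp add: regressor_law_on_def)
    interpret L: finite_measure ?L
      by (rule finite_measure_regressor_law_on[OF model positive_part_vec_binary])
    \<comment> \<open>Both sides are the law of X on {Y = \<open>y\<^sup>+\<close>}: the two models
      share this law and the base measure \<open>?L\<close>.\<close>
    have "density ?L (?r \<beta>) = density ?L (?r \<beta>')"
      using regressor_law_on_odds[OF model diff, of p] regressor_law_on_odds[OF model' diff, of p]
      by (simp add: cong)
    then have "AE x in ?L. ?r \<beta> x = ?r \<beta>' x"
      by (intro L.density_unique) measurable
    then have "AE x in ?L. exp ((\<beta> v* (x ** W_perp)) $ p) = exp ((\<beta>' v* (x ** W_perp)) $ p)"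
      by simp
    moreover have "Measurable.pred borel
        (\<lambda>x. exp ((\<beta> v* (x ** W_perp)) $ p) = exp ((\<beta>' v* (x ** W_perp)) $ p))"
      by measurable
    ultimately have "AE \<omega> in M. exp ((\<beta> v* (X \<omega> ** W_perp)) $ p) = exp ((\<beta>' v* (X \<omega> ** W_perp)) $ p)"
      by (intro AE_regressor_law_on_imp_AE[OF model positive_part_vec_binary])
    then show ?thesis
      by simp
  qed
  \<comment> \<open>There are finitely many columns, so the exceptional null sets can be united. The
    direction \<beta> - \<beta>' then contradicts the condition on X.\<close>
  then have "AE \<omega> in M. \<forall>p. (\<beta> v* (X \<omega> ** W_perp)) $ p = (\<beta>' v* (X \<omega> ** W_perp)) $ p"
    by (simp add: AE_all_countable)
  then have "AE \<omega> in M. (\<beta> - \<beta>') v* (X \<omega> ** W_perp) = 0"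
    by eventually_elim (simp add: vec_eq_iff vector_matrix_mult_def algebra_simps sum_subtractf)
  with \<open>\<beta> \<noteq> \<beta>'\<close> assms(3) show False
    unfolding no_degenerate_direction_def by (metis right_minus_eq)
qed

end
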